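(* Let $\mathscr{I}^{\nearrow}_{\infty}(\mathbb{Z})$ be the monoid of all injective monotone partial selfmaps of $\mathbb{Z}$ with cofinite domain and range, and $\mathscr{I}^{\looparrowright}_{\infty}(\mathbb{Z})$ the monoid of all injective almost monotone partial selfmaps of $\mathbb{Z}$ with cofinite domain and range. If a topological semigroup $S$ satisfies one of the following conditions: (i) $S$ is compact; (ii) $S$ is $\Gamma$-compact; (iii) the square $S\times S$ is countably compact; (iv) $S$ is a countably compact topological inverse semigroup; or (v) the square $S\times S$ is a Tychonoff pseudocompact space, then $S$ does not contain the semigroup $\mathscr{I}^{\nearrow}_{\infty}(\mathbb{Z})$ (and hence does not contain the semigroup $\mathscr{I}^{\looparrowright}_{\infty}(\mathbb{Z})$).
   Context: A partial map $\alpha\colon\mathbb{Z}\rightharpoonup\mathbb{Z}$ is monotone if $n\leqslant m$ implies $(n)\alpha\leqslant(m)\alpha$ for $n,m\in\operatorname{dom}\alpha$; it is almost monotone if there is a finite $F\subseteq\operatorname{dom}\alpha$ such that the restriction of $\alpha$ to $\operatorname{dom}\alpha\setminus F$ is monotone. $\mathscr{I}^{\nearrow}_{\infty}(\mathbb{Z})$ (resp. $\mathscr{I}^{\looparrowright}_{\infty}(\mathbb{Z})$) is the set of all injective monotone (resp. injective almost monotone) partial maps $\alpha\colon\mathbb{Z}\rightharpoonup\mathbb{Z}$ with $|\mathbb{Z}\setminus\operatorname{dom}\alpha|<\infty$ and $|\mathbb{Z}\setminus\operatorname{ran}\alpha|<\infty$, with composition $x(\alpha\beta)=(x\alpha)\beta$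 for $x\in\operatorname{dom}(\alpha\beta)=\{y\in\operatorname{dom}\alpha\mid y\alpha\in\operatorname{dom}\beta\}$ (maps are written on the right). A topological semigroup is a Hausdorff space with a jointly continuous semigroup operation; a topological inverse semigroup is a topological semigroup that is an inverse semigroup with continuous inversion. "Contains" means: has a subsemigroup (algebraically) isomorphic to the given semigroup. A topological semigroup $S$ is $\Gamma$-compact if for every $x\in S$ the closure of $\{x,x^2,x^3,\ldots\}$ in $S$ is compact. A space is countably compact if each countable open cover has a finite subcover; pseudocompact if each locally finite open cover is finite (for Tychonoff spaces, equivalently, every continuous real-valued function is bounded). *)

theory Defs
  imports "HOL-Analysis.Analysis"
begin

section \<open>Semigroups on a carrier set\<close>

definition semigroup_on :: "'a set \<Rightarrow> ('a \<Rightarrow> 'a \<Rightarrow> 'a) \<Rightarrow> bool" where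
  "semigroup_on A f \<longleftrightarrow>
     (\<forall>x\<in>A. \<forall>y\<in>A. f x y \<in> A) \<and>
     (\<forall>x\<in>A. \<forall>y\<in>A. \<forall>z\<in>A. f (f x y) z = f x (f y z))"

definition subsemigroup :: "'a set \<Rightarrow> 'a set \<Rightarrow> ('a \<Rightarrow> 'a \<Rightarrow> 'a) \<Rightarrow> bool" where
  "subsemigroup T A f \<longleftrightarrow> T \<subseteq> A \<and> (\<forall>x\<in>T. \<forall>y\<in>T. f x y \<in> T)"

definition semigroup_iso ::
    "('b \<Rightarrow> 'a) \<Rightarrow> 'b set \<Rightarrow> ('b \<Rightarrow> 'b \<Rightarrow> 'b) \<Rightarrow> 'a set \<Rightarrow> ('a \<Rightarrow> 'a \<Rightarrow> 'a) \<Rightarrow> bool" where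
  "semigroup_iso h B g A f \<longleftrightarrow>
     bij_betw h B A \<and> (\<forall>x\<in>B. \<forall>y\<in>B. h (g x y) = f (h x) (h y))"

definition contains_semigroup ::
    "'a set \<Rightarrow> ('a \<Rightarrow> 'a \<Rightarrow> 'a) \<Rightarrow> 'b set \<Rightarrow> ('b \<Rightarrow> 'b \<Rightarrow> 'b) \<Rightarrow> bool" where
  "contains_semigroup A f B g \<longleftrightarrow>
     (\<exists>T. subsemigroup T A f \<and> (\<exists>h. semigroup_iso h B g T f))"

definition is_semigroup_inverse :: "'a set \<Rightarrow> ('a \<Rightarrow> 'a \<Rightarrow> 'a) \<Rightarrow> 'a \<Rightarrow> 'a \<Rightarrow> bool" where
  "is_semigroup_inverse A f x y \<longleftrightarrow> y \<in> A \<and> f (f x y) x = x \<and> f (f y x) y = y"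

definition inverse_semigroup_on :: "'a set \<Rightarrow> ('a \<Rightarrow> 'a \<Rightarrow> 'a) \<Rightarrow> bool" where
  "inverse_semigroup_on A f \<longleftrightarrow>
     semigroup_on A f \<and> (\<forall>x\<in>A. \<exists>!y. is_semigroup_inverse A f x y)"

definition semigroup_inv :: "'a set \<Rightarrow> ('a \<Rightarrow> 'a \<Rightarrow> 'a) \<Rightarrow> 'a \<Rightarrow> 'a" where
  "semigroup_inv A f x = (THE y. is_semigroup_inverse A f x y)"

text \<open>A semigroup need not have a unit, so the exponent is shifted:
  \<open>spow f x n\<close> is the power of \<open>x\<close> with exponent \<open>n + 1\<close>.\<close>

primrec spow :: "('a \<Rightarrow> 'a \<Rightarrow> 'a) \<Rightarrow> 'a \<Rightarrow> nat \<Rightarrow> 'a" where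
  "spow f x 0 = x"
| "spow f x (Suc n) = f (spow f x n) x"

section \<open>Topological semigroups and compactness-like properties\<close>

text \<open>The underlying set of a topological semigroup is the topspace of its topology.\<close>

definition topological_semigroup :: "'a topology \<Rightarrow> ('a \<Rightarrow> 'a \<Rightarrow> 'a) \<Rightarrow> bool" where
  "topological_semigroup X f \<longleftrightarrow>
     Hausdorff_space X \<and> semigroup_on (topspace X) f \<and>
     continuous_map (prod_topology X X) X (\<lambda>(x, y). f x y)"

definition topological_inverse_semigroup :: "'a topology \<Rightarrow> ('a \<Rightarrow> 'a \<Rightarrow> 'a) \<Rightarrow> bool" where
  "topological_inverse_semigroup X f \<longleftrightarrow>
     topological_semigroup X f \<and> inverse_semigroup_on (topspace X) f \<and>
     continuous_map X X (semigroup_inv (topspace X) f)"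

definition Gamma_compact :: "'a topology \<Rightarrow> ('a \<Rightarrow> 'a \<Rightarrow> 'a) \<Rightarrow> bool" where
  "Gamma_compact X f \<longleftrightarrow>
     (\<forall>x \<in> topspace X. compactin X (X closure_of range (spow f x)))"

definition open_cover :: "'a topology \<Rightarrow> 'a set set \<Rightarrow> bool" where
  "open_cover X \<U> \<longleftrightarrow> (\<forall>U\<in>\<U>. openin X U) \<and> \<Union>\<U> = topspace X"

definition countably_compact_space :: "'a topology \<Rightarrow> bool" where
  "countably_compact_space X \<longleftrightarrow>
     (\<forall>\<U>. countable \<U> \<and> open_cover X \<U> \<longrightarrow>
        (\<exists>\<F>. finite \<F> \<and> \<F> \<subseteq> \<U> \<and> \<Union>\<F> = topspace X))"

definition pseudocompact_space :: "'a topology \<Rightarrow> bool" where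
  "pseudocompact_space X \<longleftrightarrow>
     (\<forall>\<U>. open_cover X \<U> \<and> locally_finite_in X \<U> \<longrightarrow> finite \<U>)"

definition Tychonoff_space :: "'a topology \<Rightarrow> bool" where
  "Tychonoff_space X \<longleftrightarrow> completely_regular_space X \<and> Hausdorff_space X"

section \<open>Monoids of cofinite partial injections of the integers\<close>

definition pmonotone :: "(int \<rightharpoonup> int) \<Rightarrow> bool" where
  "pmonotone \<alpha> \<longleftrightarrow>
     (\<forall>n \<in> dom \<alpha>. \<forall>m \<in> dom \<alpha>. n \<le> m \<longrightarrow> the (\<alpha> n) \<le> the (\<alpha> m))"

definition almost_pmonotone :: "(int \<rightharpoonup> int) \<Rightarrow> bool" where
  "almost_pmonotone \<alpha> \<longleftrightarrow>
     (\<exists>F. finite F \<and> F \<subseteq> dom \<alpha> \<and> pmonotone (\<alpha> |` (dom \<alpha> - F)))"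

text \<open>\<open>inj_on \<alpha> (dom \<alpha>)\<close> is injectivity of the partial map: on its domain \<open>\<alpha>\<close> only
  takes values of the form \<open>Some k\<close>.\<close>

definition cofinite_pinj :: "(int \<rightharpoonup> int) set" where
  "cofinite_pinj = {\<alpha>. inj_on \<alpha> (dom \<alpha>) \<and> finite (UNIV - dom \<alpha>) \<and> finite (UNIV - ran \<alpha>)}"

definition I_mono :: "(int \<rightharpoonup> int) set" where
  "I_mono = {\<alpha> \<in> cofinite_pinj. pmonotone \<alpha>}"

definition I_almost_mono :: "(int \<rightharpoonup> int) set" where
  "I_almost_mono = {\<alpha> \<in> cofinite_pinj. almost_pmonotone \<alpha>}"

text \<open>Maps are written on the right: in the product \<open>\<alpha> \<beta>\<close> the map \<open>\<alpha>\<close> acts first,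
  whereas \<open>\<circ>\<^sub>m\<close> applies its right argument first.\<close>

definition pcomp :: "(int \<rightharpoonup> int) \<Rightarrow> (int \<rightharpoonup> int) \<Rightarrow> (int \<rightharpoonup> int)" where
  "pcomp \<alpha> \<beta> = \<beta> \<circ>\<^sub>m \<alpha>"

lemma pcomp_assoc: "pcomp (pcomp \<alpha> \<beta>) \<gamma> = pcomp \<alpha> (pcomp \<beta> \<gamma>)"
  by (auto simp: pcomp_def map_comp_def fun_eq_iff split: option.splits)

lemma dom_pcomp: "dom (pcomp \<alpha> \<beta>) = {y \<in> dom \<alpha>. the (\<alpha> y) \<in> dom \<beta>}"
  by (auto simp: pcomp_def map_comp_def dom_def split: option.splits)

lemma cofinite_pinj_pcomp:
  assumes a: "\<alpha> \<in> cofinite_pinj" and b: "\<beta> \<in> cofinite_pinj"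
  shows "pcomp \<alpha> \<beta> \<in> cofinite_pinj"
proof -
  have ia: "\<And>x y k. \<alpha> x = Some k \<Longrightarrow> \<alpha> y = Some k \<Longrightarrow> x = y"
    and ib: "\<And>x y k. \<beta> x = Some k \<Longrightarrow> \<beta> y = Some k \<Longrightarrow> x = y"
    using a b by (auto simp: cofinite_pinj_def inj_on_def dom_def)
  have fa: "finite (UNIV - dom \<alpha>)" "finite (UNIV - ran \<alpha>)"
    and fb: "finite (UNIV - dom \<beta>)" "finite (UNIV - ran \<beta>)"
    using a b by (auto simp: cofinite_pinj_def)
  have "inj_on (pcomp \<alpha> \<beta>) (dom (pcomp \<alpha> \<beta>))"
    by (auto simp: inj_on_def pcomp_def map_comp_def dom_def split: option.splits)
      (metis ia ib)
  moreover have "finite (UNIV - dom (pcomp \<alpha> \<beta>))"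
  proof (rule finite_subset)
    have "inj_on (\<lambda>y. the (\<alpha> y)) (dom \<alpha>)"
      using ia by (auto simp: inj_on_def dom_def)
    then have "finite ((\<lambda>y. the (\<alpha> y)) -` (UNIV - dom \<beta>) \<inter> dom \<alpha>)"
      by (rule finite_vimage_IntI[OF fb(1)])
    then show "finite ((UNIV - dom \<alpha>) \<union> ((\<lambda>y. the (\<alpha> y)) -` (UNIV - dom \<beta>) \<inter> dom \<alpha>))"
      using fa by blast
  qed (auto simp: dom_pcomp)
  moreover have "finite (UNIV - ran (pcomp \<alpha> \<beta>))"
  proof (rule finite_subset)
    show "finite ((UNIV - ran \<beta>) \<union> (\<lambda>y. the (\<beta> y)) ` (UNIV - ran \<alpha>))"
      using fa fb by blast
    show "UNIV - ran (pcomp \<alpha> \<beta>) \<subseteq> (UNIV - ran \<beta>) \<union> (\<lambda>y. the (\<beta> y)) ` (UNIV - ran \<alpha>)"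
    proof
      fix z assume z: "z \<in> UNIV - ran (pcomp \<alpha> \<beta>)"
      show "z \<in> (UNIV - ran \<beta>) \<union> (\<lambda>y. the (\<beta> y)) ` (UNIV - ran \<alpha>)"
      proof (cases "z \<in> ran \<beta>")
        case True
        then obtain y where y: "\<beta> y = Some z" by (auto simp: ran_def)
        have "y \<notin> ran \<alpha>"
        proof
          assume "y \<in> ran \<alpha>"
          then obtain x where "\<alpha> x = Some y" by (auto simp: ran_def)
          then have "pcomp \<alpha> \<beta> x = Some z" using y by (simp add: pcomp_def)
          then show False using z by (auto simp: ran_def)
        qed
        then show ?thesis using y by force
      qed simp
    qed
  qed
  ultimately show ?thesis by (simp add: cofinite_pinj_def)
qed

lemma pmonotone_iff:
  "pmonotone \<alpha> \<longleftrightarrow> (\<forall>n m k l. \<alpha> n = Some k \<and> \<alpha> m = Some l \<and> n \<le> m \<longrightarrow> k \<le> l)"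
  by (force simp: pmonotone_def dom_def)

lemma pmonotone_pcomp: "pmonotone \<alpha> \<Longrightarrow> pmonotone \<beta> \<Longrightarrow> pmonotone (pcomp \<alpha> \<beta>)"
  unfolding pmonotone_iff pcomp_def map_comp_Some_iff by blast

lemma almost_pmonotone_pcomp:
  assumes "inj_on \<alpha> (dom \<alpha>)" "almost_pmonotone \<alpha>" "almost_pmonotone \<beta>"
  shows "almost_pmonotone (pcomp \<alpha> \<beta>)"
proof -
  obtain F where F: "finite F" "F \<subseteq> dom \<alpha>" "pmonotone (\<alpha> |` (dom \<alpha> - F))"
    using assms by (auto simp: almost_pmonotone_def)
  obtain G where G: "finite G" "G \<subseteq> dom \<beta>" "pmonotone (\<beta> |` (dom \<beta> - G))"
    using assms by (auto simp: almost_pmonotone_def)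
  define H where "H = (F \<union> ((\<lambda>y. the (\<alpha> y)) -` G \<inter> dom \<alpha>)) \<inter> dom (pcomp \<alpha> \<beta>)"
  have "inj_on (\<lambda>y. the (\<alpha> y)) (dom \<alpha>)"
    using assms(1) by (auto simp: inj_on_def dom_def)
  then have "finite H"
    using F(1) finite_vimage_IntI[OF G(1)] by (auto simp: H_def)
  moreover have "pcomp \<alpha> \<beta> |` (dom (pcomp \<alpha> \<beta>) - H) =
      pcomp (\<alpha> |` (dom \<alpha> - F)) (\<beta> |` (dom \<beta> - G))"
    by (rule ext)
      (auto simp: H_def pcomp_def map_comp_def restrict_map_def dom_def split: option.splits)
  ultimately show ?thesis
    using pmonotone_pcomp[OF F(3) G(3)] unfolding almost_pmonotone_def
    by (metis H_def Int_lower2)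
qed

lemma semigroup_on_I_mono: "semigroup_on I_mono pcomp"
  by (auto simp: semigroup_on_def I_mono_def pcomp_assoc cofinite_pinj_pcomp pmonotone_pcomp)

lemma semigroup_on_I_almost_mono: "semigroup_on I_almost_mono pcomp"
  by (auto simp: semigroup_on_def I_almost_mono_def pcomp_assoc cofinite_pinj_pcomp
      intro!: almost_pmonotone_pcomp) (simp add: cofinite_pinj_def)

lemma subsemigroup_I_mono: "subsemigroup I_mono I_almost_mono pcomp"
proof -
  have "almost_pmonotone \<alpha>" if "pmonotone \<alpha>" for \<alpha>
    unfolding almost_pmonotone_def
    using that by (intro exI[of _ "{}"]) (simp add: pmonotone_iff restrict_map_def)
  then show ?thesis
    using semigroup_on_I_mono
    by (auto simp: subsemigroup_def semigroup_on_def I_mono_def I_almost_mono_def)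
qed

end

(* The maps a (shift the non-negative integers up by one, fix the negative ones) and b = a^{-1}
   satisfy a b = 1 and b a \<noteq> 1.  In a semigroup S containing them put p, q, e for the images of
   a, b, 1.  The set C = {z. z (q p) = z} is closed, contains all positive powers of p, and omits e;
   hence p^n q^n = e is not in C while p^m q^n is in C for m > n.

   Under (i)-(iv) the sequence (p^n, q^n) has a cluster point (x, y) in S \<times> S.  Then x y = e, so a
   neighbourhood of (x, y) is mapped into the complement of C; but it contains (p^n, q^n) and
   (p^m, q^m), hence (p^m, q^n) if it is a box, for some n < m.

   Under (v) take a continuous g with g(e) = 0 and g = 1 on C.  Since S \<times> S is pseudocompact,
   the maps x \<mapsto> g(x y) are equicontinuous (a lemma behind Glicksberg's theorem), so the pseudometric
   d(x, x') = sup_y |g(x y) - g(x' y)| is continuous.  The p^n are 1-separated for d, which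
   contradicts pseudocompactness. *)
theory Submission
  imports Defs
begin

section \<open>Cluster points of sequences from countable and relative compactness\<close>

section \<open>Cluster points\<close>

text \<open>Infinitely many indices are demanded, not infinitely many values, so a constant sequence
  clusters at its value and every neighbourhood supplies two indices n < m.\<close>

definition cluster_point :: "'a topology \<Rightarrow> (nat \<Rightarrow> 'a) \<Rightarrow> 'a \<Rightarrow> bool" where
  "cluster_point X s x \<longleftrightarrow>
     x \<in> topspace X \<and> (\<forall>U. openin X U \<and> x \<in> U \<longrightarrow> infinite {n. s n \<in> U})"

lemma cluster_pointD:
  "cluster_point X s x \<Longrightarrow> openin X U \<Longrightarrow> x \<in> U \<Longrightarrow> infinite {n. s n \<in> U}"
  by (simp add: cluster_point_def)

text \<open>The closures \<open>K n\<close> of the tails have the finite intersection property, so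
  countable compactness gives them a common point, and such a point is a cluster point.\<close>

lemma countably_compact_imp_cluster_point:
  assumes cc: "countably_compact_space X" and s: "\<And>n. s n \<in> topspace X"
  obtains x where "cluster_point X s x"
proof -
  define K where "K n = X closure_of (s ` {n..})" for n
  have sub: "s ` {n..} \<subseteq> K n" for n
    unfolding K_def by (rule closure_of_subset) (use s in auto)
  have anti: "K m \<subseteq> K n" if "n \<le> m" for n m
    unfolding K_def using that by (intro closure_of_mono) auto
  have "(\<Union>n. topspace X - K n) \<noteq> topspace X"
  proof
    assume cover: "(\<Union>n. topspace X - K n) = topspace X"
    have "open_cover X (range (\<lambda>n. topspace X - K n))"
      using cover by (auto simp: open_cover_def K_def)
    then obtain \<F> where \<F>: "finite \<F>" "\<F> \<subseteq> range (\<lambda>n. topspace X - K n)" "\<Union>\<F> = topspace X"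
      using cc unfolding countably_compact_space_def
      by (meson countable_image countableI_type)
    then obtain N where N: "finite N" "\<F> = (\<lambda>n. topspace X - K n) ` N"
      by (meson finite_subset_image)
    \<comment> \<open>Once \<open>M\<close> bounds the chosen indices, \<open>s M\<close> lies in
      every chosen tail and escapes the finite subcover.\<close>
    obtain M where M: "\<And>n. n \<in> N \<Longrightarrow> n \<le> M"
      using N(1) by (meson finite_nat_set_iff_bounded_le)
    have "s M \<in> K n" if "n \<in> N" for n
      using sub[of n] M[OF that] by auto
    then show False
      using \<F>(3) N(2) s[of M] by blast
  qed
  then obtain x where x: "x \<in> topspace X" "\<And>n. x \<in> K n"
    by blast
  have "infinite {n. s n \<in> U}" if "openin X U" "x \<in> U" for U
    unfolding infinite_nat_iff_unbounded_le
  proof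
    fix m
    have "\<exists>y\<in>s ` {m..}. y \<in> U"
      using x(2)[of m] that unfolding K_def in_closure_of by blast
    then show "\<exists>n\<ge>m. n \<in> {n. s n \<in> U}"
      by auto
  qed
  with x have "cluster_point X s x"
    by (auto simp: cluster_point_def)
  then show ?thesis
    by (rule that)
qed

lemma compact_imp_countably_compact_space:
  "compact_space X \<Longrightarrow> countably_compact_space X"
  unfolding countably_compact_space_def open_cover_def compact_space by simp

lemma compactin_imp_cluster_point:
  assumes K: "compactin X K" and s: "\<And>n. s n \<in> K"
  obtains x where "cluster_point X s x"
proof -
  have KX: "K \<subseteq> topspace X"
    using K by (rule compactin_subset_topspace)
  have "countably_compact_space (subtopology X K)"
    using K by (simp add: compact_space_subtopology compact_imp_countably_compact_space)
  then obtain x where x: "cluster_point (subtopology X K) s x"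
    using countably_compact_imp_cluster_point[of "subtopology X K" s] s KX by auto
  have "infinite {n. s n \<in> U}" if "openin X U" "x \<in> U" for U
  proof -
    have "openin (subtopology X K) (U \<inter> K)" "x \<in> U \<inter> K"
      using x that by (auto simp: cluster_point_def openin_subtopology)
    then have "infinite {n. s n \<in> U \<inter> K}"
      using cluster_pointD[OF x] by blast
    then show ?thesis
      using s by simp
  qed
  with x have "cluster_point X s x"
    by (auto simp: cluster_point_def)
  then show ?thesis
    by (rule that)
qed

lemma infinite_natE_less:
  assumes "infinite {n::nat. P n}"
  obtains m n where "m < n" "P m" "P n"
  using assms unfolding infinite_nat_iff_unbounded by blast

section \<open>Equicontinuity on pseudocompact products\<close>

section \<open>Pseudocompact products\<close>

text \<open>A sequence of open sets without a cluster point is a locally finite family.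
  Pseudocompactness only bounds the number of distinct sets, so repetitions need a separate
  argument.\<close>

lemma pseudocompact_imp_cluster:
  assumes pc: "pseudocompact_space X"
    and G: "\<And>n. openin X (G n)" "\<And>n. G n \<noteq> {}"
  shows "\<exists>x\<in>topspace X. \<forall>U. openin X U \<and> x \<in> U \<longrightarrow> infinite {n::nat. G n \<inter> U \<noteq> {}}"
proof (rule ccontr)
  assume "\<not> ?thesis"
  then have fin: "\<exists>U. openin X U \<and> x \<in> U \<and> finite {n. G n \<inter> U \<noteq> {}}"
    if "x \<in> topspace X" for x
    using that by blast
  \<comment> \<open>Adding the whole space makes the family a cover and keeps it locally
    finite.\<close>
  let ?\<U> = "insert (topspace X) (range G)"
  have "locally_finite_in X ?\<U>"
    unfolding locally_finite_in_def
  proof (intro conjI ballI)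
    show "\<Union>?\<U> \<subseteq> topspace X"
      using G(1) openin_subset by auto
    fix x assume "x \<in> topspace X"
    with fin obtain U where U: "openin X U" "x \<in> U" "finite {n. G n \<inter> U \<noteq> {}}"
      by blast
    have "{V \<in> ?\<U>. V \<inter> U \<noteq> {}} \<subseteq> insert (topspace X) (G ` {n. G n \<inter> U \<noteq> {}})"
      by auto
    then have "finite {V \<in> ?\<U>. V \<inter> U \<noteq> {}}"
      using U(3) by (meson finite.insertI finite_imageI finite_subset)
    with U show "\<exists>V. openin X V \<and> x \<in> V \<and> finite {U \<in> ?\<U>. U \<inter> V \<noteq> {}}"
      by blast
  qed
  moreover have "open_cover X ?\<U>"
    using G(1) openin_subset by (auto simp: open_cover_def)
  ultimately have "finite (range G)"
    using pc by (auto simp: pseudocompact_space_def)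
  \<comment> \<open>Some set \<open>G k\<close> recurs infinitely often, and every neighbourhood of
    a point of it meets all its copies.\<close>
  then obtain k where k: "infinite {n. G n = G k}"
    using pigeonhole_infinite[of "UNIV :: nat set" G] by auto
  obtain x where x: "x \<in> G k"
    using G(2) by blast
  then obtain U where U: "x \<in> U" "finite {n. G n \<inter> U \<noteq> {}}"
    using fin G(1) openin_subset by blast
  have "{n. G n = G k} \<subseteq> {n. G n \<inter> U \<noteq> {}}"
    using x U(1) by auto
  with U(2) k show False
    using finite_subset by blast
qed

lemma continuous_map_prod_real_box:
  fixes F :: "'a \<times> 'b \<Rightarrow> real"
  assumes F: "continuous_map (prod_topology X Y) euclideanreal F"
    and xy: "x \<in> topspace X" "y \<in> topspace Y" and "\<epsilon> > 0"
  obtains A B where "openin X A" "x \<in> A" "openin Y B" "y \<in> B"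
    "\<And>a b. a \<in> A \<Longrightarrow> b \<in> B \<Longrightarrow> \<bar>F (a, b) - F (x, y)\<bar> < \<epsilon>"
proof -
  let ?W = "{z \<in> topspace (prod_topology X Y). F z \<in> ball (F (x, y)) \<epsilon>}"
  have "openin (prod_topology X Y) ?W"
    using F by (rule openin_continuous_map_preimage) auto
  moreover have "(x, y) \<in> ?W"
    using xy \<open>\<epsilon> > 0\<close> by simp
  ultimately obtain A B where "openin X A" "x \<in> A" "openin Y B" "y \<in> B" "A \<times> B \<subseteq> ?W"
    unfolding openin_prod_topology_alt by meson
  then show ?thesis
    by (intro that[of A B]) (auto simp: dist_real_def abs_minus_commute subset_iff)
qed

text \<open>If equicontinuity fails at \<open>x0\<close>, choose boxes U n \<times> V n and
  shrinking neighbourhoods W n of \<open>x0\<close> with U (n+1) inside W n, such that F(a, b) and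
  F(c, b) stay apart for a in U n, b in V n, c in W n. The boxes cluster at some point, where this
  contradicts continuity of \<open>F\<close>.\<close>

lemma pseudocompact_prod_equicontinuous:
  fixes F :: "'a \<times> 'b \<Rightarrow> real"
  assumes pc: "pseudocompact_space (prod_topology X Y)"
    and F: "continuous_map (prod_topology X Y) euclideanreal F"
    and x0: "x0 \<in> topspace X" and "\<epsilon> > 0"
  obtains U where "openin X U" "x0 \<in> U"
    "\<And>x y. x \<in> U \<Longrightarrow> y \<in> topspace Y \<Longrightarrow> \<bar>F (x, y) - F (x0, y)\<bar> < \<epsilon>"
proof (rule ccontr)
  note witness = that
  assume "\<not> thesis"
  then have bad: "\<exists>x\<in>W. \<exists>y\<in>topspace Y. \<bar>F (x, y) - F (x0, y)\<bar> \<ge> \<epsilon>"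
    if "openin X W" "x0 \<in> W" for W
    using that \<open>\<not> thesis\<close> witness[of W] by (meson not_le_imp_less)
  \<comment> \<open>A failure at two points is spread by continuity to open sets, where
    pseudocompactness can act on it.\<close>
  define good where "good = (\<lambda>(U, V, W).
     openin X U \<and> U \<noteq> {} \<and> openin Y V \<and> V \<noteq> {} \<and> openin X W \<and> x0 \<in> W \<and>
     (\<forall>a\<in>U. \<forall>b\<in>V. \<forall>c\<in>W. \<bar>F (a, b) - F (c, b)\<bar> > \<epsilon>/2))"
  have step: "\<exists>U V W'. good (U, V, W') \<and> U \<subseteq> W \<and> W' \<subseteq> W" if W: "openin X W" "x0 \<in> W" for W
  proof -
    obtain x y where xy: "x \<in> W" "y \<in> topspace Y" "\<bar>F (x, y) - F (x0, y)\<bar> \<ge> \<epsilon>"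
      using bad[OF W] by blast
    have x: "x \<in> topspace X"
      using xy(1) W(1) openin_subset by blast
    obtain A B where AB: "openin X A" "x \<in> A" "openin Y B" "y \<in> B"
      "\<And>a b. a \<in> A \<Longrightarrow> b \<in> B \<Longrightarrow> \<bar>F (a, b) - F (x, y)\<bar> < \<epsilon>/4"
      using continuous_map_prod_real_box[OF F x xy(2), of "\<epsilon>/4"] \<open>\<epsilon> > 0\<close> by auto
    obtain C D where CD: "openin X C" "x0 \<in> C" "openin Y D" "y \<in> D"
      "\<And>c b. c \<in> C \<Longrightarrow> b \<in> D \<Longrightarrow> \<bar>F (c, b) - F (x0, y)\<bar> < \<epsilon>/4"
      using continuous_map_prod_real_box[OF F x0 xy(2), of "\<epsilon>/4"] \<open>\<epsilon> > 0\<close> by auto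
    \<comment> \<open>The gap \<epsilon> at the two points loses at most \<epsilon>/4 at each end;
      \<open>b\<close> must lie in both \<open>B\<close> and \<open>D\<close> for the two
      estimates.\<close>
    have "\<bar>F (a, b) - F (c, b)\<bar> > \<epsilon>/2" if "a \<in> A" "b \<in> B \<inter> D" "c \<in> C" for a b c
      using AB(5)[of a b] CD(5)[of c b] xy(3) that by (auto simp: abs_if split: if_splits)
    then have "good (A \<inter> W, B \<inter> D, C \<inter> W)"
      using AB CD W xy by (auto simp: good_def)
    then show ?thesis
      by blast
  qed
  have "\<exists>t. \<forall>n. good (t n) \<and> fst (t (Suc n)) \<subseteq> snd (snd (t n))
      \<and> snd (snd (t (Suc n))) \<subseteq> snd (snd (t n))"
  proof (rule dependent_nat_choice)
    show "\<exists>t. good t"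
      using step[of "topspace X"] x0 by blast
    fix t :: "'a set \<times> 'b set \<times> 'a set" and n :: nat
    assume "good t"
    then show "\<exists>t'. good t' \<and> fst t' \<subseteq> snd (snd t) \<and> snd (snd t') \<subseteq> snd (snd t)"
    proof -
      have "openin X (snd (snd t))" "x0 \<in> snd (snd t)"
        using \<open>good t\<close> by (auto simp: good_def)
      from step[OF this] show ?thesis
        by force
    qed
  qed
  then obtain t where t: "\<And>n. good (t n)" "\<And>n. fst (t (Suc n)) \<subseteq> snd (snd (t n))"
      "\<And>n. snd (snd (t (Suc n))) \<subseteq> snd (snd (t n))"
    by blast
  define U V W where "U n = fst (t n)" and "V n = fst (snd (t n))" and "W n = snd (snd (t n))"
    for n
  have g: "good (U n, V n, W n)" for n
    using t(1) by (simp add: U_def V_def W_def)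
  have W_anti: "W m \<subseteq> W n" if "n \<le> m" for n m
    using that
  proof (induction rule: dec_induct)
    case (step k)
    then show ?case
      using t(3)[of k] by (auto simp: W_def)
  qed simp
  have UW: "U m \<subseteq> W n" if less: "n < m" for n m
  proof -
    obtain k where "m = Suc k" "n \<le> k"
      using less by (cases m) auto
    then show ?thesis
      using t(2)[of k] W_anti[of n k] by (auto simp: U_def W_def)
  qed
  have G: "openin (prod_topology X Y) (U n \<times> V n)" "U n \<times> V n \<noteq> {}" for n
    using g[of n] by (auto simp: good_def openin_prod_Times_iff)
  obtain z where z: "z \<in> topspace (prod_topology X Y)"
      "\<And>G. openin (prod_topology X Y) G \<Longrightarrow> z \<in> G \<Longrightarrow> infinite {n. (U n \<times> V n) \<inter> G \<noteq> {}}"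
    using pseudocompact_imp_cluster[of _ "\<lambda>n. U n \<times> V n", OF pc G] by blast
  obtain x y where xy: "z = (x, y)" "x \<in> topspace X" "y \<in> topspace Y"
    using z(1) by auto
  obtain A B where AB: "openin X A" "x \<in> A" "openin Y B" "y \<in> B"
    "\<And>a b. a \<in> A \<Longrightarrow> b \<in> B \<Longrightarrow> \<bar>F (a, b) - F (x, y)\<bar> < \<epsilon>/4"
    using continuous_map_prod_real_box[OF F xy(2,3), of "\<epsilon>/4"] \<open>\<epsilon> > 0\<close> by auto
  have "infinite {n. (U n \<times> V n) \<inter> (A \<times> B) \<noteq> {}}"
    using AB xy by (intro z(2)) (auto simp: openin_prod_Times_iff)
  then obtain n m where nm: "n < m" "(U n \<times> V n) \<inter> (A \<times> B) \<noteq> {}" "(U m \<times> V m) \<inter> (A \<times> B) \<noteq> {}"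
    by (rule infinite_natE_less)
  then obtain a b c where abc: "a \<in> U n" "a \<in> A" "b \<in> V n" "b \<in> B" "c \<in> U m" "c \<in> A"
    by blast
  \<comment> \<open>The point \<open>c\<close> lies in \<open>U m\<close>, hence in
    \<open>W n\<close>. Yet (a, b) and (c, b) both lie in A \<times> B, where \<open>F\<close> is
    within \<epsilon>/4 of F(x, y).\<close>
  have "\<bar>F (a, b) - F (c, b)\<bar> > \<epsilon>/2"
    using g[of n] abc UW[OF nm(1)] by (auto simp: good_def)
  then show False
    using AB(5)[of a b] AB(5)[of c b] abc by linarith
qed

text \<open>The neighbourhoods of the s n given by equicontinuity, times \<open>Y\<close>, cluster
  at some (x, v). Two of them therefore meet a single equicontinuity neighbourhood of x.\<close>

lemma pseudocompact_prod_no_separated_sequence: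
  fixes F :: "'a \<times> 'b \<Rightarrow> real" and s :: "nat \<Rightarrow> 'a"
  assumes pc: "pseudocompact_space (prod_topology X Y)"
    and F: "continuous_map (prod_topology X Y) euclideanreal F"
    and s: "\<And>n. s n \<in> topspace X" and "\<epsilon> > 0"
  obtains m n where "m < n" "\<And>y. y \<in> topspace Y \<Longrightarrow> \<bar>F (s m, y) - F (s n, y)\<bar> < \<epsilon>"
proof (cases "topspace Y = {}")
  \<comment> \<open>Here the estimate is vacuous; the other case needs \<open>Y\<close> nonempty so
    that the boxes are nonempty.\<close>
  case True
  then show ?thesis
    using that[of 0 1] by simp
next
  case False
  have "\<epsilon>/4 > 0"
    using \<open>\<epsilon> > 0\<close> by simp
  have "\<exists>U. openin X U \<and> s n \<in> U \<and>
      (\<forall>x\<in>U. \<forall>y\<in>topspace Y. \<bar>F (x, y) - F (s n, y)\<bar> < \<epsilon>/4)" for n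
    using pseudocompact_prod_equicontinuous[OF pc F s \<open>\<epsilon>/4 > 0\<close>] by metis
  then obtain U where U: "\<And>n. openin X (U n)" "\<And>n. s n \<in> U n"
    "\<And>n x y. x \<in> U n \<Longrightarrow> y \<in> topspace Y \<Longrightarrow> \<bar>F (x, y) - F (s n, y)\<bar> < \<epsilon>/4"
    by metis
  have G: "openin (prod_topology X Y) (U n \<times> topspace Y)" "U n \<times> topspace Y \<noteq> {}" for n
    using U(1,2)[of n] False by (auto simp: openin_prod_Times_iff)
  obtain z where z: "z \<in> topspace (prod_topology X Y)"
      "\<And>G. openin (prod_topology X Y) G \<Longrightarrow> z \<in> G \<Longrightarrow> infinite {n. (U n \<times> topspace Y) \<inter> G \<noteq> {}}"
    using pseudocompact_imp_cluster[of _ "\<lambda>n. U n \<times> topspace Y", OF pc G] by blast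
  obtain x v where xv: "z = (x, v)" "x \<in> topspace X" "v \<in> topspace Y"
    using z(1) by auto
  obtain A where A: "openin X A" "x \<in> A"
    "\<And>a y. a \<in> A \<Longrightarrow> y \<in> topspace Y \<Longrightarrow> \<bar>F (a, y) - F (x, y)\<bar> < \<epsilon>/4"
    using pseudocompact_prod_equicontinuous[OF pc F xv(2) \<open>\<epsilon>/4 > 0\<close>] by metis
  have "infinite {n. (U n \<times> topspace Y) \<inter> (A \<times> topspace Y) \<noteq> {}}"
    using A xv by (intro z(2)) (auto simp: openin_prod_Times_iff)
  then obtain m n where mn: "m < n" "(U m \<times> topspace Y) \<inter> (A \<times> topspace Y) \<noteq> {}"
      "(U n \<times> topspace Y) \<inter> (A \<times> topspace Y) \<noteq> {}"
    by (rule infinite_natE_less)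
  then obtain a b where ab: "a \<in> U m" "a \<in> A" "b \<in> U n" "b \<in> A"
    by blast
  \<comment> \<open>The chain s m, a, x, b, s n has four links, each contributing less than
    \<epsilon>/4.\<close>
  have "\<bar>F (s m, y) - F (s n, y)\<bar> < \<epsilon>" if "y \<in> topspace Y" for y
    using U(3)[OF ab(1) that] U(3)[OF ab(3) that] A(3)[OF ab(2) that] A(3)[OF ab(4) that]
    by linarith
  with mn(1) show ?thesis
    by (rule that)
qed

section \<open>Algebra of the powers of p and q\<close>

section \<open>One-sided inverses in topological semigroups\<close>

text \<open>The image of a unit under an embedding need not be a unit of the larger semigroup, so
  \<open>e\<close> is neutral only for \<open>p\<close> and \<open>q\<close>.\<close>

locale one_sided_inverse =
  fixes A :: "'a set" and f :: "'a \<Rightarrow> 'a \<Rightarrow> 'a" and p q e :: 'a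
  assumes semigroup: "semigroup_on A f"
    and p: "p \<in> A" and q: "q \<in> A"
    and pq: "f p q = e"
    and ep: "f e p = p" and pe: "f p e = p" and eq: "f e q = q" and qe: "f q e = q"
begin

lemma closed [simp]: "x \<in> A \<Longrightarrow> y \<in> A \<Longrightarrow> f x y \<in> A"
  and assoc: "x \<in> A \<Longrightarrow> y \<in> A \<Longrightarrow> z \<in> A \<Longrightarrow> f (f x y) z = f x (f y z)"
  using semigroup by (auto simp: semigroup_on_def)

lemma e [simp]: "e \<in> A"
  using p q pq closed by blast

lemma spow_closed [simp]: "x \<in> A \<Longrightarrow> spow f x n \<in> A"
  by (induction n) auto

lemma spow_commute: "x \<in> A \<Longrightarrow> f (spow f x n) x = f x (spow f x n)"
  by (induction n) (auto simp: assoc)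

lemma e_spow_p: "f e (spow f p n) = spow f p n"
  by (induction n) (auto simp: ep p assoc[symmetric])

lemma e_spow_q: "f e (spow f q n) = spow f q n"
  by (induction n) (auto simp: eq q assoc[symmetric])

lemma spow_q_e: "f (spow f q n) e = spow f q n"
  by (induction n) (auto simp: qe q assoc)

text \<open>The last factor p absorbs q p, because p q p = e p = p.\<close>

lemma spow_p_absorb: "f (spow f p n) (f q p) = spow f p n"
proof -
  have "f p (f q p) = p"
    using p q by (simp add: assoc[symmetric] pq ep)
  then show ?thesis
    by (cases n) (auto simp: assoc p q)
qed

lemma p_spow_q_Suc: "f p (spow f q (Suc n)) = spow f q n"
  using p q by (simp only: spow.simps spow_commute) (simp add: assoc[symmetric] pq e_spow_q)

text \<open>The innermost pair p q cancels repeatedly; the index shift is the same on both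
  sides.\<close>

lemma spow_p_spow_q: "f (spow f p n) (spow f q n) = e"
proof (induction n)
  case (Suc n)
  have "f (spow f p (Suc n)) (spow f q (Suc n)) = f (spow f p n) (f p (spow f q (Suc n)))"
    using p q by (simp del: spow.simps(2) add: spow.simps(2)[of f p] assoc)
  then show ?case
    by (simp only: p_spow_q_Suc Suc)
qed (simp add: pq)

text \<open>Index n stands for exponent n + 1, so adding exponents adds an extra \<open>Suc\<close>
  to the indices.\<close>

lemma spow_add: "x \<in> A \<Longrightarrow> spow f x (Suc (m + n)) = f (spow f x m) (spow f x n)"
  by (induction n) (auto simp: assoc)

lemma spow_p_Suc_add_spow_q: "f (spow f p (Suc (k + n))) (spow f q n) = f (spow f p k) e"
  using p q by (simp only: spow_add) (simp add: assoc spow_p_spow_q)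

text \<open>Cancelling all factors q leaves a positive power of p, which absorbs q p.\<close>

lemma spow_p_spow_q_absorb:
  assumes "n < m"
  shows "f (f (spow f p m) (spow f q n)) (f q p) = f (spow f p m) (spow f q n)"
proof -
  obtain k where k: "m = Suc (k + n)"
    using assms less_imp_Suc_add by (metis add.commute)
  have "f (spow f p k) e = spow f p k"
    by (cases k) (auto simp: assoc p pe)
  then show ?thesis
    by (simp only: k spow_p_Suc_add_spow_q spow_p_absorb)
qed

text \<open>In an inverse semigroup this forces inversion to carry the powers of p to those of q, as
  case (iv) requires.\<close>

lemma is_semigroup_inverse_spow: "is_semigroup_inverse A f (spow f p n) (spow f q n)"
  using p q
  by (simp add: is_semigroup_inverse_def spow_p_spow_q e_spow_p)
    (simp add: assoc spow_p_spow_q spow_q_e)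

end

section \<open>Topological contradictions from a proper one-sided inverse\<close>

text \<open>This is the equalizer of right translation by \<open>c\<close> and the identity, two
  continuous maps into a Hausdorff space.\<close>

lemma topological_semigroup_closedin_right_absorb:
  assumes S: "topological_semigroup S f" and c: "c \<in> topspace S"
  shows "closedin S {z \<in> topspace S. f z c = z}"
proof -
  have "continuous_map S (prod_topology S S) (\<lambda>z. (z, c))"
    using c by (intro continuous_map_pairedI) auto
  then have "continuous_map S S ((\<lambda>(x, y). f x y) \<circ> (\<lambda>z. (z, c)))"
    using S continuous_map_compose by (auto simp: topological_semigroup_def)
  then have "continuous_map S S (\<lambda>z. f z c)"
    by (simp add: o_def)
  then show ?thesis
    using S by (intro closedin_continuous_maps_eq[where Y = S])
      (auto simp: topological_semigroup_def)
qed

text \<open>Conditions (i)-(iv) all reduce to this, differing only in how the cluster point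
  arises.\<close>

lemma cluster_point_semigroup_False:
  assumes S: "topological_semigroup S f"
    and xy: "cluster_point (prod_topology S S) (\<lambda>n. (P n, Q n)) (x, y)"
    and PQ: "\<And>n. f (P n) (Q n) = e" and e: "e \<in> topspace S"
    and C: "closedin S C" "e \<notin> C" and PQC: "\<And>m n. n < m \<Longrightarrow> f (P m) (Q n) \<in> C"
  shows False
proof -
  have mult: "continuous_map (prod_topology S S) S (\<lambda>(x, y). f x y)"
    and H: "Hausdorff_space S"
    using S by (auto simp: topological_semigroup_def)
  have preim: "openin (prod_topology S S)
      {z \<in> topspace (prod_topology S S). (\<lambda>(x, y). f x y) z \<in> W}" if "openin S W" for W
    using openin_continuous_map_preimage[OF mult that] .
  have xyS: "(x, y) \<in> topspace (prod_topology S S)"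
    using xy by (simp add: cluster_point_def)
  then have fxy: "f x y \<in> topspace S"
    using S by (auto simp: topological_semigroup_def semigroup_on_def)
  have "f x y = e"
  proof (rule ccontr)
    assume ne: "f x y \<noteq> e"
    \<comment> \<open>Otherwise infinitely many products P n Q n would avoid \<open>e\<close>,
      although all of them equal it.\<close>
    have "openin S (topspace S - {e})"
      using H e by (simp add: closedin_Hausdorff_singleton openin_diff)
    from preim[OF this] have "infinite {n. (P n, Q n) \<in>
        {z \<in> topspace (prod_topology S S). (\<lambda>(x, y). f x y) z \<in> topspace S - {e}}}"
      using xyS fxy ne by (intro cluster_pointD[OF xy]) auto
    then show False
      by (simp add: PQ)
  qed
  then have "(x, y) \<in> {z \<in> topspace (prod_topology S S). (\<lambda>(x, y). f x y) z \<in> topspace S - C}"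
    using xyS e C by simp
  moreover have "openin S (topspace S - C)"
    using C by blast
  ultimately obtain U V where UV: "openin S U" "openin S V" "x \<in> U" "y \<in> V"
      "U \<times> V \<subseteq> {z \<in> topspace (prod_topology S S). (\<lambda>(x, y). f x y) z \<in> topspace S - C}"
    using preim unfolding openin_prod_topology_alt by meson
  then have "infinite {n. (P n, Q n) \<in> U \<times> V}"
    by (intro cluster_pointD[OF xy]) (auto simp: openin_prod_Times_iff)
  then obtain n m where "n < m" "(P n, Q n) \<in> U \<times> V" "(P m, Q m) \<in> U \<times> V"
    by (rule infinite_natE_less)
  \<comment> \<open>A box containing two pairs also contains the mixed pair (P m, Q n).\<close>
  then have "f (P m) (Q n) \<notin> C"
    using UV(5) by (auto simp: subset_iff)
  then show False
    using PQC \<open>n < m\<close> by blast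
qed

lemma pseudocompact_semigroup_False:
  assumes S: "topological_semigroup S f"
    and T: "Tychonoff_space (prod_topology S S)" and pc: "pseudocompact_space (prod_topology S S)"
    and P: "\<And>n. P n \<in> topspace S" and Q: "\<And>n. Q n \<in> topspace S"
    and PQ: "\<And>n::nat. f (P n) (Q n) = e" and e: "e \<in> topspace S"
    and C: "closedin S C" "e \<notin> C" and PQC: "\<And>m n. n < m \<Longrightarrow> f (P m) (Q n) \<in> C"
  shows False
proof -
  \<comment> \<open>Complete regularity passes from the square to the factor; \<open>e\<close> shows
    that the square is nonempty.\<close>
  have "completely_regular_space S"
    using T e unfolding Tychonoff_space_def completely_regular_space_prod_topology
    by (auto simp: null_topspace_iff_trivial)
  then obtain g where "continuous_map S (top_of_set {0..1::real}) g" and ge: "g e = 0"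
      and gC: "g ` C \<subseteq> {1}"
    using C e unfolding completely_regular_space_def by (metis DiffI)
  then have g: "continuous_map S euclideanreal g"
    by (simp add: continuous_map_in_subtopology)
  have "continuous_map (prod_topology S S) euclideanreal (g \<circ> (\<lambda>(x, y). f x y))"
    using S g by (auto simp: topological_semigroup_def intro: continuous_map_compose)
  then obtain n m where nm: "n < m"
      "\<And>y. y \<in> topspace S \<Longrightarrow> \<bar>(g \<circ> (\<lambda>(x, y). f x y)) (P n, y) - (g \<circ> (\<lambda>(x, y). f x y)) (P m, y)\<bar> < 1"
    using pseudocompact_prod_no_separated_sequence[of S S _ P, OF pc _ P zero_less_one] by blast
  have "g (f (P m) (Q n)) = 1"
    using PQC[OF nm(1)] gC by auto
  \<comment> \<open>At y = Q n the two values are g(e) = 0 and 1, a gap of exactly the excluded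
    size.\<close>
  then show False
    using nm(2)[OF Q, of n] by (simp add: PQ ge)
qed

lemma compact_space_imp_Gamma_compact:
  "compact_space S \<Longrightarrow> Gamma_compact S f"
  by (simp add: Gamma_compact_def closedin_compact_space)

text \<open>A pair with q p different from e would generate a copy of the bicyclic monoid; its
  powers already give the contradiction.\<close>

lemma topological_semigroup_one_sided_inverse:
  assumes S: "topological_semigroup S f"
    and cpt: "compact_space S
       \<or> Gamma_compact S f
       \<or> countably_compact_space (prod_topology S S)
       \<or> (topological_inverse_semigroup S f \<and> countably_compact_space S)
       \<or> (Tychonoff_space (prod_topology S S) \<and> pseudocompact_space (prod_topology S S))"
    and osi: "one_sided_inverse (topspace S) f p q e"
  shows "f q p = e"
proof (rule ccontr)
  interpret one_sided_inverse "topspace S" f p q e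
    by (fact osi)
  assume ne: "f q p \<noteq> e"
  define P Q where "P = spow f p" and "Q = spow f q"
  define C where "C = {z \<in> topspace S. f z (f q p) = z}"
  have P: "P n \<in> topspace S" and Q: "Q n \<in> topspace S" for n
    using p q by (auto simp: P_def Q_def)
  have PQ: "f (P n) (Q n) = e" for n
    by (simp add: P_def Q_def spow_p_spow_q)
  \<comment> \<open>Hence \<open>e\<close> would belong to \<open>C\<close> only if q p = e.\<close>
  have "f e (f q p) = f q p"
    using p q by (simp add: assoc[symmetric] eq)
  then have C: "closedin S C" "e \<notin> C"
    using ne p q topological_semigroup_closedin_right_absorb[OF S] by (auto simp: C_def)
  have PQC: "f (P m) (Q n) \<in> C" if "n < m" for m n
    using spow_p_spow_q_absorb[OF that] P Q by (auto simp: C_def P_def Q_def)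
  have no_cluster: "\<not> cluster_point (prod_topology S S) (\<lambda>n. (P n, Q n)) z" for z
    using cluster_point_semigroup_False[of S f P Q, OF S _ PQ e C PQC] by (cases z) blast
  have "\<not> Gamma_compact S f"
  proof
    assume "Gamma_compact S f"
    \<comment> \<open>The condition is applied to p and to q separately; the product of the two
      closures is compact and contains every pair (P n, Q n).\<close>
    then have "compactin (prod_topology S S) ((S closure_of range P) \<times> (S closure_of range Q))"
      using p q by (simp add: Gamma_compact_def compactin_Times P_def Q_def)
    moreover have "range P \<subseteq> S closure_of range P" "range Q \<subseteq> S closure_of range Q"
      using P Q by (auto intro!: closure_of_subset)
    ultimately show False
      using compactin_imp_cluster_point[of "prod_topology S S" _ "\<lambda>n. (P n, Q n)"] no_cluster
      by (metis (mono_tags) SigmaI range_subsetD)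
  qed
  moreover have "\<not> countably_compact_space (prod_topology S S)"
    using countably_compact_imp_cluster_point[of "prod_topology S S" "\<lambda>n. (P n, Q n)"]
      no_cluster P Q by auto
  moreover have "\<not> (topological_inverse_semigroup S f \<and> countably_compact_space S)"
  proof
    assume S': "topological_inverse_semigroup S f \<and> countably_compact_space S"
    define \<iota> where "\<iota> = semigroup_inv (topspace S) f"
    have inv: "\<iota> (P n) = Q n" for n
      unfolding \<iota>_def semigroup_inv_def
      using S' is_semigroup_inverse_spow[of n] P[of n]
      by (intro the1_equality)
        (auto simp: P_def Q_def topological_inverse_semigroup_def inverse_semigroup_on_def)
    obtain x where x: "cluster_point S P x"
      using S' countably_compact_imp_cluster_point P by metis
    \<comment> \<open>Only \<open>S\<close> is countably compact here, so only \<open>P\<close> is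
      known to cluster; the graph of inversion lifts its cluster point to the square.\<close>
    have graph: "continuous_map S (prod_topology S S) (\<lambda>x. (x, \<iota> x))"
      using S' by (intro continuous_map_pairedI)
        (auto simp: topological_inverse_semigroup_def \<iota>_def)
    have "infinite {n. (P n, Q n) \<in> U}" if U: "openin (prod_topology S S) U" "(x, \<iota> x) \<in> U" for U
    proof -
      have "infinite {n. P n \<in> {x \<in> topspace S. (x, \<iota> x) \<in> U}}"
        using x U openin_continuous_map_preimage[OF graph U(1)]
        by (intro cluster_pointD[OF x]) (auto simp: cluster_point_def)
      then show ?thesis
        by (simp add: inv P)
    qed
    moreover have "(x, \<iota> x) \<in> topspace (prod_topology S S)"
      using x graph unfolding cluster_point_def by (meson continuous_map_image_subset_topspace image_subset_iff)
    ultimately show False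
      using no_cluster unfolding cluster_point_def by blast
  qed
  moreover have "\<not> (Tychonoff_space (prod_topology S S) \<and> pseudocompact_space (prod_topology S S))"
    using pseudocompact_semigroup_False[of S f P Q, OF S _ _ P Q PQ e C PQC] by blast
  ultimately show False
    using cpt compact_space_imp_Gamma_compact by blast
qed

section \<open>A one-sided inverse pair of monotone shifts, and the theorem\<close>

section \<open>The shift of the non-negative integers\<close>

definition shift_up :: "int \<rightharpoonup> int" where
  "shift_up x = Some (if x < 0 then x else x + 1)"

definition shift_down :: "int \<rightharpoonup> int" where
  "shift_down x = (if x < 0 then Some x else if x = 0 then None else Some (x - 1))"

lemma shift_up_I_mono: "shift_up \<in> I_mono"
proof -
  have "x \<in> ran shift_up" if "x \<noteq> 0" for x
    using that by (intro ranI[of _ "if x < 0 then x else x - 1"]) (auto simp: shift_up_def)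
  then have "UNIV - ran shift_up \<subseteq> {0}"
    by blast
  then have "finite (UNIV - ran shift_up)"
    by (rule finite_subset) simp
  then show ?thesis
    by (auto simp: I_mono_def cofinite_pinj_def pmonotone_iff inj_on_def shift_up_def dom_def
        split: if_splits)
qed

lemma shift_down_I_mono: "shift_down \<in> I_mono"
proof -
  have "x \<in> ran shift_down" for x
    by (intro ranI[of _ "if x < 0 then x else x + 1"]) (auto simp: shift_down_def)
  then have "finite (UNIV - ran shift_down)"
    by (simp add: Diff_eq_empty_iff[THEN iffD2] subsetI)
  moreover have "UNIV - dom shift_down \<subseteq> {0}"
    by (auto simp: shift_down_def dom_def)
  then have "finite (UNIV - dom shift_down)"
    by (rule finite_subset) simp
  ultimately show ?thesis
    by (auto simp: I_mono_def cofinite_pinj_def pmonotone_iff inj_on_def shift_down_def dom_def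
        split: if_splits)
qed

lemma Some_I_mono: "Some \<in> I_mono"
  by (auto simp: I_mono_def cofinite_pinj_def pmonotone_iff inj_on_def ran_def)

lemma pcomp_Some [simp]: "pcomp Some \<alpha> = \<alpha>" "pcomp \<alpha> Some = \<alpha>"
  by (auto simp: pcomp_def map_comp_def split: option.splits)

lemma pcomp_shift_up_down: "pcomp shift_up shift_down = Some"
  by (auto simp: pcomp_def map_comp_def shift_up_def shift_down_def)

text \<open>The two maps differ at 0, where \<open>shift_down\<close> is undefined.\<close>

lemma pcomp_shift_down_up: "pcomp shift_down shift_up \<noteq> Some"
  by (auto simp: pcomp_def map_comp_def shift_down_def fun_eq_iff intro!: exI[of _ 0])

theorem corollary4p9:
  fixes S :: "'a topology" and f :: "'a \<Rightarrow> 'a \<Rightarrow> 'a"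
  assumes "topological_semigroup S f"
    and "compact_space S
       \<or> Gamma_compact S f
       \<or> countably_compact_space (prod_topology S S)
       \<or> (topological_inverse_semigroup S f \<and> countably_compact_space S)
       \<or> (Tychonoff_space (prod_topology S S) \<and> pseudocompact_space (prod_topology S S))"
  shows "\<not> contains_semigroup (topspace S) f I_mono pcomp
       \<and> \<not> contains_semigroup (topspace S) f I_almost_mono pcomp"
proof -
  \<comment> \<open>A general \<open>B\<close> treats both monoids at once: only the two shifts, the
    identity and closure under products matter.\<close>
  have "\<not> contains_semigroup (topspace S) f B pcomp"
    if B: "I_mono \<subseteq> B" "semigroup_on B pcomp" for B
  proof
    assume "contains_semigroup (topspace S) f B pcomp"
    then obtain T h where T: "T \<subseteq> topspace S" and h: "bij_betw h B T"
      and hom: "\<And>x y. x \<in> B \<Longrightarrow> y \<in> B \<Longrightarrow> h (pcomp x y) = f (h x) (h y)"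
      by (auto simp: contains_semigroup_def subsemigroup_def semigroup_iso_def)
    have mem: "shift_up \<in> B" "shift_down \<in> B" "Some \<in> B"
      using B(1) shift_up_I_mono shift_down_I_mono Some_I_mono by auto
    have hS: "h x \<in> topspace S" if "x \<in> B" for x
      using that h T by (auto simp: bij_betw_def)
    have "one_sided_inverse (topspace S) f (h shift_up) (h shift_down) (h Some)"
      using assms(1) mem hS
      by unfold_locales
        (auto simp: topological_semigroup_def hom[symmetric] pcomp_shift_up_down)
    then have "h (pcomp shift_down shift_up) = h Some"
      using topological_semigroup_one_sided_inverse[OF assms] mem hom by simp
    moreover have "pcomp shift_down shift_up \<in> B"
      using B(2) mem by (auto simp: semigroup_on_def)
    \<comment> \<open>Injectivity of \<open>h\<close> would make the two shifts inverse on both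
      sides.\<close>
    ultimately show False
      using h mem(3) pcomp_shift_down_up by (auto simp: bij_betw_def inj_on_def)
  qed
  then show ?thesis
    using semigroup_on_I_mono semigroup_on_I_almost_mono subsemigroup_I_mono
    by (auto simp: subsemigroup_def)
qed

end
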